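(* Let $I(n,k)$ be defined as in the context and let $J(n,k):=2^k(n+k-1)!\,I(n,k)$. Then for every $n\ge1$, the power series $\sum_{k\ge0}J(n,k)t^k$ is the expansion of the rational function $$-\frac{1}{(2t)^{n-1}}\sum_{m=1}^{n}\frac{(-1)^m}{m}\sum_{(n_1,\dots,n_m)}\frac{1}{n_1!\cdots n_m!}\,\frac{1}{1-(n_1^2+\dots+n_m^2)t},$$ where the inner sum runs over all compositions $(n_1,\dots,n_m)$ of $n$ into $m$ parts, i.e. sequences of positive integers with $n_1+\dots+n_m=n$.
   Context: The numbers $I(n,k)$ are defined recursively by: $I(n,k)=0$ if $k<0$ or $n<1$; $I(1,0)=1$; and for all $n\ge1$, $k\ge0$ with $(n,k)\neq(1,0)$, $$I(n,k)=\frac{1}{2(n+k-1)}\left(n^2 I(n,k-1)+\sum_{i=1}^{n-1}\sum_{j=0}^{k} i(n-i)\,I(i,j)\,I(n-i,k-j)\right).$$ (Combinatorially, $I(n,k)$ is the sum of the inverses of the orders of the automorphism groups of all pairwise non-isomorphic connected multigraphs, loops and multiple edges allowed, on $n$ vertices with cyclomatic number $k$.) *)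

theory Defs
  imports "HOL-Complex_Analysis.Complex_Analysis"
begin

function I_num :: "int \<Rightarrow> int \<Rightarrow> rat" where
  "I_num n k =
     (if k < 0 \<or> n < 1 then 0
      else if n = 1 \<and> k = 0 then 1
      else 1 / (2 * of_int (n + k - 1)) *
             (of_int (n\<^sup>2) * I_num n (k - 1) +
              (\<Sum>i = 1..n - 1. \<Sum>j = 0..k.
                 of_int (i * (n - i)) * I_num i j * I_num (n - i) (k - j))))"
  by pat_completeness auto
termination
  by (relation "measures [\<lambda>(n, k). nat n, \<lambda>(n, k). nat (k + 1)]") auto

declare I_num.simps [simp del]

text \<open>Meaningful for \<open>n \<ge> 1\<close>, so that the natural-number subtraction does not truncate.\<close>

definition J_num :: "nat \<Rightarrow> nat \<Rightarrow> rat" where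
  "J_num n k = 2 ^ k * fact (n + k - 1) * I_num (int n) (int k)"

definition compositions :: "nat \<Rightarrow> nat \<Rightarrow> nat list set" where
  "compositions n m = {ns. length ns = m \<and> (\<forall>x\<in>set ns. 0 < x) \<and> sum_list ns = n}"

lemma finite_compositions: "finite (compositions n m)"
proof (rule finite_subset)
  show "compositions n m \<subseteq> {ns. set ns \<subseteq> {..n} \<and> length ns = m}"
    by (auto simp: compositions_def dest: member_le_sum_list)
  show "finite {ns. set ns \<subseteq> {..n} \<and> length ns = m}"
    by (rule finite_lists_length_eq) simp
qed

text \<open>The formula has a removable singularity at 0, where division by zero gives a meaningless
  value.  The relation \<open>has_laurent_expansion\<close> ignores the value at 0: it compares function and
  series on a punctured neighbourhood of 0.  Against a series of the form \<open>fps_to_fls F\<close> it says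
  that \<open>F\<close> is the power series expansion.\<close>

definition J_rational :: "nat \<Rightarrow> complex \<Rightarrow> complex" where
  "J_rational n t =
     - (1 / (2 * t) ^ (n - 1)) *
       (\<Sum>m = 1..n. (-1) ^ m / of_nat m *
          (\<Sum>ns\<in>compositions n m.
             1 / (\<Prod>x\<leftarrow>ns. fact x) * (1 / (1 - of_nat (\<Sum>x\<leftarrow>ns. x\<^sup>2) * t))))"

end

theory Submission
  imports Defs
begin

unbundle no vec_syntax

text \<open>The exponential generating function of all multigraphs is
  \<open>F(x, y) = (\<Sum>n. x\<^sup>n / n! * exp (n\<^sup>2 y / 2))\<close>, where \<open>y\<close> marks edges.  It satisfies the heat
  equation \<open>F\<^sub>y = 1/2 (x d/dx)\<^sup>2 F\<close>, so \<open>L = ln F\<close> satisfies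
  \<open>L\<^sub>y = 1/2 ((x d/dx)\<^sup>2 L + (x d/dx L)\<^sup>2)\<close> with \<open>L = x\<close> at \<open>y = 0\<close>.  In coefficients this is the
  recursion for \<open>I(n, k)\<close>, whence \<open>I(n, k)\<close> is the coefficient of \<open>x\<^sup>n y\<^bsup>n+k-1\<^esup>\<close> in \<open>L\<close>.
  Expanding the logarithm in powers of \<open>F - 1\<close> gives the sum over compositions, and the
  terms of order below \<open>n - 1\<close> in \<open>y\<close> cancel because \<open>I(n, k) = 0\<close> for \<open>k < 0\<close>.\<close>

subsection \<open>Logarithms of bivariate power series\<close>

text \<open>The outer variable is \<open>x\<close>, and the coefficients are series in
  \<open>y\<close>. If \<open>G $ 0 = 0\<close>, then \<open>G ^ m\<close> has no term in
  \<open>x^n\<close> for \<open>m > n\<close>, so stopping at \<open>m = n\<close> yields the full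
  series \<open>ln (1 + G)\<close>.\<close>

definition fps2_log1p :: "'a::field_char_0 fps fps \<Rightarrow> 'a fps fps" where
  "fps2_log1p G = Abs_fps (\<lambda>n. \<Sum>m=1..n. fps_const ((-1) ^ (m + 1) / of_nat m) * (G ^ m) $ n)"

lemma fps2_log1p_nth_0 [simp]: "fps2_log1p G $ 0 = 0"
  by (simp add: fps2_log1p_def)

lemma fps2_log1p_nth_truncate:
  assumes "G $ 0 = 0" "n \<le> N"
  shows "fps2_log1p G $ n =
    (\<Sum>m=1..N. fps_const (fps_const ((-1) ^ (m + 1) / of_nat m)) * G ^ m) $ n"
proof -
  have "(\<Sum>m=1..n. fps_const ((-1) ^ (m + 1) / of_nat m) * (G ^ m) $ n) =
    (\<Sum>m=1..N. fps_const ((-1) ^ (m + 1) / of_nat m) * (G ^ m) $ n)"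
    using assms startsby_zero_power_prefix[OF assms(1)]
    by (intro sum.mono_neutral_left) auto
  then show ?thesis
    by (simp add: fps2_log1p_def fps_sum_nth)
qed

text \<open>The hypothesis \<open>local\<close> is what lets a derivation pass through the infinite sum defining the
  logarithm.\<close>

lemma derivation_fps2_log1p:
  fixes D :: "'a::field_char_0 fps fps \<Rightarrow> 'a fps fps"
  assumes add: "\<And>f g. D (f + g) = D f + D g"
    and mult: "\<And>f g. D (f * g) = D f * g + f * D g"
    and const: "\<And>c. D (fps_const (fps_const c)) = 0"
    and local: "\<And>f g n. (\<And>k. k \<le> n \<Longrightarrow> f $ k = g $ k) \<Longrightarrow> D f $ n = D g $ n"
    and G0: "G $ 0 = 0"
  shows "D (fps2_log1p G) * (1 + G) = D G"
proof (rule fps_ext)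
  fix n
  define c :: "nat \<Rightarrow> 'a fps fps"
    where "c m = fps_const (fps_const ((-1) ^ (m + 1) / of_nat m))" for m
  have D0: "D 0 = 0" and D1: "D 1 = 0"
    using const[of 0] const[of 1] by simp_all
  have pow: "D (G ^ Suc m) = of_nat (Suc m) * G ^ m * D G" for m
    by (induction m) (simp_all add: mult D1 algebra_simps)
  have c_Suc: "c (Suc m) * of_nat (Suc m) = (-1) ^ m" for m
  proof -
    have "c (Suc m) * of_nat (Suc m) = fps_const (fps_const ((-1) ^ m))"
      by (simp add: c_def fps_of_nat[symmetric] del: of_nat_Suc)
    also have "\<dots> = (-1) ^ m"
      by (simp flip: fps_const_power fps_const_neg)
    finally show ?thesis .
  qed
  \<comment> \<open>\<open>D\<close> maps the partial sum to \<open>D G\<close> times the geometric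
    sum of the \<open>(- G) ^ m\<close> with \<open>m < N\<close>, and the factor
    \<open>1 + G\<close> makes this telescope.\<close>
  have partial: "D (\<Sum>m=1..N. c m * G ^ m) * (1 + G) = D G * (1 - (- G) ^ N)" for N
  proof (induction N)
    case 0
    then show ?case by (simp add: D0)
  next
    case (Suc N)
    have "D (c (Suc N) * G ^ Suc N) = c (Suc N) * of_nat (Suc N) * (G ^ N * D G)"
      using const by (simp only: mult pow) (simp add: c_def mult.assoc)
    also have "\<dots> = (- G) ^ N * D G"
      by (simp only: c_Suc) (simp add: power_minus[of G] mult.assoc)
    finally have "D (\<Sum>m=1..Suc N. c m * G ^ m) * (1 + G) =
        D (\<Sum>m=1..N. c m * G ^ m) * (1 + G) + (- G) ^ N * D G * (1 + G)"
      by (simp add: add distrib_right del: power_Suc)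
    then show ?case
      unfolding Suc.IH by (simp add: algebra_simps)
  qed
  \<comment> \<open>With \<open>Suc n\<close> terms, the remainder \<open>(- G) ^ Suc n\<close> only
    starts beyond order \<open>n\<close>.\<close>
  define T where "T = (\<Sum>m=1..Suc n. c m * G ^ m)"
  have eq: "D (fps2_log1p G) $ i = D T $ i" if "i \<le> n" for i
  proof (rule local)
    fix k
    assume "k \<le> i"
    then show "fps2_log1p G $ k = T $ k"
      unfolding T_def c_def using that G0 by (intro fps2_log1p_nth_truncate) auto
  qed
  have "(D (fps2_log1p G) * (1 + G)) $ n = (D T * (1 + G)) $ n"
    unfolding fps_mult_nth by (intro sum.cong refl) (simp add: eq)
  also have "\<dots> = (D G * (1 - (- G) ^ Suc n)) $ n"
    unfolding T_def partial ..
  also have "\<dots> = D G $ n - (D G * (- G) ^ Suc n) $ n"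
    by (simp add: right_diff_distrib del: power_Suc)
  also have "(D G * (- G) ^ Suc n) $ n = 0"
    using startsby_zero_power_prefix[of "- G" "Suc n"] G0
    by (simp add: fps_mult_nth del: power_Suc)
  finally show "(D (fps2_log1p G) * (1 + G)) $ n = D G $ n"
    by simp
qed

text \<open>This is \<open>x d/dx\<close>, which, unlike \<open>d/dx\<close>, acts diagonally on the
  coefficients of the outer series.\<close>

definition fps2_theta :: "'a::comm_ring_1 fps fps \<Rightarrow> 'a fps fps" where
  "fps2_theta f = fps_X * fps_deriv f"

definition fps2_deriv_coeffs :: "'a::comm_ring_1 fps fps \<Rightarrow> 'a fps fps" where
  "fps2_deriv_coeffs f = Abs_fps (\<lambda>n. fps_deriv (f $ n))"

lemma fps2_theta_nth [simp]: "fps2_theta f $ n = of_nat n * f $ n"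
  by (cases n) (simp_all add: fps2_theta_def)

lemma fps2_deriv_coeffs_nth [simp]: "fps2_deriv_coeffs f $ n = fps_deriv (f $ n)"
  by (simp add: fps2_deriv_coeffs_def)

lemma fps2_theta_mult: "fps2_theta (f * g) = fps2_theta f * g + f * fps2_theta g"
  by (simp add: fps2_theta_def algebra_simps)

lemma fps2_deriv_coeffs_mult:
  "fps2_deriv_coeffs (f * g) = fps2_deriv_coeffs f * g + f * fps2_deriv_coeffs g"
  by (rule fps_ext) (simp add: fps_mult_nth fps_deriv_sum sum.distrib)

lemma fps2_theta_log1p:
  fixes G :: "'a::field_char_0 fps fps"
  assumes "G $ 0 = 0"
  shows "fps2_theta (fps2_log1p G) * (1 + G) = fps2_theta G"
  using assms
  by (intro derivation_fps2_log1p) (auto simp: fps2_theta_mult fps2_theta_def algebra_simps)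

lemma fps2_deriv_coeffs_log1p:
  fixes G :: "'a::field_char_0 fps fps"
  assumes "G $ 0 = 0"
  shows "fps2_deriv_coeffs (fps2_log1p G) * (1 + G) = fps2_deriv_coeffs G"
  using assms
  by (intro derivation_fps2_log1p) (auto simp: fps2_deriv_coeffs_mult fps_eq_iff)

subsection \<open>The generating function of multigraphs\<close>

definition multigraph_gf :: "'a::field_char_0 fps fps" where
  "multigraph_gf = Abs_fps (\<lambda>n. fps_const (1 / fact n) * fps_exp (of_nat (n\<^sup>2) / 2))"

definition connected_gf :: "'a::field_char_0 fps fps" where
  "connected_gf = fps2_log1p (multigraph_gf - 1)"

lemma multigraph_gf_nth:
  "multigraph_gf $ n = fps_const (1 / fact n) * fps_exp (of_nat (n\<^sup>2) / 2)"
  by (simp add: multigraph_gf_def)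

lemma multigraph_gf_nth_0 [simp]: "multigraph_gf $ 0 = 1"
  by (simp add: multigraph_gf_nth)

lemma multigraph_gf_nonzero: "multigraph_gf \<noteq> 0"
  by (metis fps_zero_nth multigraph_gf_nth_0 zero_neq_one)

text \<open>On \<open>exp (n^2 y / 2)\<close>, the operator \<open>2 d/dy\<close> is multiplication
  by \<open>n^2\<close>, and so is \<open>(x d/dx)^2\<close> on \<open>x^n\<close>.\<close>

lemma multigraph_gf_heat:
  "fps_const 2 * fps2_deriv_coeffs multigraph_gf = fps2_theta (fps2_theta multigraph_gf)"
proof (rule fps_ext)
  fix n
  show "(fps_const 2 * fps2_deriv_coeffs multigraph_gf) $ n =
      fps2_theta (fps2_theta (multigraph_gf :: 'a fps fps)) $ n"
    by (rule fps_ext) (simp add: multigraph_gf_nth fps_of_nat[symmetric] numeral_fps_const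
        power2_eq_square field_simps del: fps_exp_nth fps_deriv_nth)
qed

lemma connected_gf_theta:
  "fps2_theta connected_gf * multigraph_gf = fps2_theta multigraph_gf"
  using fps2_theta_log1p[of "multigraph_gf - 1"]
  by (simp add: connected_gf_def) (simp add: fps2_theta_def)

lemma connected_gf_deriv_coeffs:
  "fps2_deriv_coeffs connected_gf * multigraph_gf = fps2_deriv_coeffs multigraph_gf"
proof -
  have "fps2_deriv_coeffs (multigraph_gf - 1) = fps2_deriv_coeffs (multigraph_gf :: 'a fps fps)"
    by (rule fps_ext) simp
  then show ?thesis
    using fps2_deriv_coeffs_log1p[of "multigraph_gf - 1 :: 'a fps fps"]
    by (simp add: connected_gf_def)
qed

text \<open>The Cole-Hopf substitution: after multiplication by \<open>F\<close>, the product rule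
  reduces the claim to the heat equation for \<open>F\<close>. The nonzero factor \<open>F\<close>
  then cancels in the integral domain of bivariate series.\<close>

lemma connected_gf_pde:
  "fps_const 2 * fps2_deriv_coeffs connected_gf =
     fps2_theta (fps2_theta connected_gf) + fps2_theta connected_gf * fps2_theta connected_gf"
proof -
  let ?F = "multigraph_gf :: 'a fps fps" and ?C = "connected_gf :: 'a fps fps"
  have "fps_const 2 * fps2_deriv_coeffs ?C * ?F = fps2_theta (fps2_theta ?C * ?F)"
    by (simp only: mult.assoc connected_gf_deriv_coeffs multigraph_gf_heat connected_gf_theta)
  also have "\<dots> = fps2_theta (fps2_theta ?C) * ?F + fps2_theta ?C * (fps2_theta ?C * ?F)"
    by (subst fps2_theta_mult) (simp only: connected_gf_theta)
  also have "\<dots> = (fps2_theta (fps2_theta ?C) + fps2_theta ?C * fps2_theta ?C) * ?F"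
    by (simp add: algebra_simps)
  finally show ?thesis
    using multigraph_gf_nonzero[where 'a = 'a] by simp
qed

text \<open>At \<open>y = 0\<close> the multigraph series becomes \<open>exp x\<close>, whose
  logarithm is \<open>x\<close>.\<close>

lemma connected_gf_nth_0: "connected_gf $ n $ 0 = (if n = 1 then 1 else (0 :: 'a::field_char_0))"
proof -
  define T where "T = Abs_fps (\<lambda>n. fps2_theta (connected_gf :: 'a fps fps) $ n $ 0)"
  have "T * fps_exp 1 = fps_X * fps_exp 1"
  proof (rule fps_ext)
    fix n
    have "(T * fps_exp 1) $ n =
        (fps2_theta connected_gf * (multigraph_gf :: 'a fps fps)) $ n $ 0"
      by (simp add: T_def fps_mult_nth fps_sum_nth multigraph_gf_nth)
    also have "\<dots> = (fps_X * fps_exp 1) $ n"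
      unfolding connected_gf_theta
      by (cases n) (simp_all add: multigraph_gf_nth fps_of_nat[symmetric] field_simps
          del: of_nat_Suc)
    finally show "(T * fps_exp 1) $ n = (fps_X * fps_exp 1) $ n" .
  qed
  moreover have "fps_exp 1 \<noteq> (0 :: 'a fps)"
    by (metis fps_exp_nth fps_zero_nth fact_0 of_nat_1 power_0 div_by_1 zero_neq_one)
  ultimately have "T = fps_X"
    by simp
  then have "T $ n = fps_X $ n"
    by simp
  then have "of_nat n * connected_gf $ n $ 0 = (if n = 1 then 1 else (0 :: 'a))"
    by (simp add: T_def fps_of_nat[symmetric])
  \<comment> \<open>The factor \<open>n\<close> loses the coefficient at \<open>n = 0\<close>; that
    one is 0 by definition of the logarithm.\<close>
  then show ?thesis
    by (cases "n = 0") (auto simp: connected_gf_def split: if_splits)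
qed

text \<open>Comparing coefficients of \<open>x^n y^e\<close> in the differential equation. The
  right-hand side involves only exponents of \<open>y\<close> up to \<open>e\<close>, so an
  induction on \<open>e\<close> can use it.\<close>

lemma connected_gf_nth_Suc:
  "2 * of_nat (Suc e) * connected_gf $ n $ Suc e = of_nat (n\<^sup>2) * connected_gf $ n $ e +
     (\<Sum>i=0..n. \<Sum>a=0..e. of_nat (i * (n - i)) *
        (connected_gf $ i $ a * (connected_gf $ (n - i) $ (e - a) :: 'a::field_char_0)))"
proof -
  let ?C = "connected_gf :: 'a fps fps"
  have of_nat_nth: "(of_nat k * f) $ e = of_nat k * f $ e" for k and f :: "'a fps"
    by (simp add: fps_of_nat[symmetric])
  have "fps2_theta (fps2_theta ?C) $ n $ e = of_nat (n\<^sup>2) * ?C $ n $ e"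
    by (simp add: of_nat_nth power2_eq_square mult.assoc)
  moreover have "(fps2_theta ?C * fps2_theta ?C) $ n $ e =
      (\<Sum>i=0..n. \<Sum>a=0..e. of_nat (i * (n - i)) * (?C $ i $ a * ?C $ (n - i) $ (e - a)))"
  proof -
    have "(fps2_theta ?C * fps2_theta ?C) $ n =
        (\<Sum>i=0..n. of_nat (i * (n - i)) * (?C $ i * ?C $ (n - i)))"
      unfolding fps_mult_nth by (intro sum.cong refl) simp
    then show ?thesis
      by (simp only: fps_sum_nth of_nat_nth) (simp only: fps_mult_nth sum_distrib_left)
  qed
  moreover have "(fps_const 2 * fps2_deriv_coeffs ?C) $ n $ e =
      2 * of_nat (Suc e) * ?C $ n $ Suc e"
    by (simp add: numeral_fps_const mult.assoc del: of_nat_Suc)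
  ultimately show ?thesis
    unfolding connected_gf_pde by (simp only: fps_add_nth)
qed

subsection \<open>Identification with the recursion\<close>

lemma I_num_eq_0: "k < 0 \<or> n < 1 \<Longrightarrow> I_num n k = 0"
  by (subst I_num.simps) simp

lemma I_num_1_0: "I_num 1 0 = 1"
  by (subst I_num.simps) simp

text \<open>A connected multigraph with \<open>i\<close> vertices and \<open>a\<close> edges has
  cyclomatic number \<open>j = a - i + 1\<close>; this substitution passes from splitting edges to
  splitting cyclomatic numbers.\<close>

lemma I_num_convolution:
  fixes n i e :: nat
  assumes "1 \<le> i" "i < n"
  shows "(\<Sum>a=0..e. I_num (int i) (int a - int i + 1) *
            I_num (int (n - i)) (int (e - a) - int (n - i) + 1)) =
         (\<Sum>j=0..int e + 2 - int n. I_num (int i) j * I_num (int n - int i) (int e + 2 - int n - j))"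
    (is "?L = ?R")
proof -
  let ?g = "\<lambda>j. I_num (int i) j * I_num (int n - int i) (int e + 2 - int n - j)"
  have "?L = (\<Sum>a=0..e. ?g (int a - int i + 1))"
    using assms by (intro sum.cong refl) (simp add: of_nat_diff algebra_simps)
  also have "\<dots> = sum ?g {1 - int i..int e - int i + 1}"
    by (rule sum.reindex_bij_witness[of _ "\<lambda>j. nat (j + int i - 1)" "\<lambda>a. int a - int i + 1"]) auto
  \<comment> \<open>As \<open>1 \<le> i < n\<close>, the shifted range contains
    \<open>{0..e + 2 - n}\<close>; outside the latter, one of the two factors has a negative second
    argument.\<close>
  also have "\<dots> = ?R"
    using assms by (intro sum.mono_neutral_right) (auto intro!: I_num_eq_0)
  finally show ?thesis .
qed

text \<open>The recursion indexed by the number \<open>Suc e\<close> of edges; it includes the trivial case of too few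
  edges, \<open>k = e + 2 - n < 0\<close>.\<close>

lemma I_num_Suc_edges:
  fixes n e :: nat
  assumes "1 \<le> n"
  shows "2 * of_nat (Suc e) * I_num (int n) (int (Suc e) - int n + 1) =
    of_nat (n\<^sup>2) * I_num (int n) (int e - int n + 1) +
    (\<Sum>i=0..n. \<Sum>a=0..e. of_nat (i * (n - i)) * (I_num (int i) (int a - int i + 1) *
        I_num (int (n - i)) (int (e - a) - int (n - i) + 1)))"
proof -
  let ?k = "int e + 2 - int n"
  \<comment> \<open>The recursion omits \<open>i = 0\<close> and \<open>i = n\<close>, where the
    weight \<open>i * (n - i)\<close> is 0.\<close>
  have boundary: "i = 0 \<or> i = n" if "i \<in> {0..n} - {1..n-1}" for i
    using that by auto
  have "(\<Sum>i=0..n. \<Sum>a=0..e. of_nat (i * (n - i)) * (I_num (int i) (int a - int i + 1) *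
        I_num (int (n - i)) (int (e - a) - int (n - i) + 1))) =
      (\<Sum>i=1..n-1. \<Sum>a=0..e. of_nat (i * (n - i)) * (I_num (int i) (int a - int i + 1) *
        I_num (int (n - i)) (int (e - a) - int (n - i) + 1)))"
    by (intro sum.mono_neutral_right) (use boundary in \<open>force simp: I_num_eq_0\<close>)+
  also have "\<dots> = (\<Sum>i=1..n-1. of_nat (i * (n - i)) *
      (\<Sum>j=0..?k. I_num (int i) j * I_num (int n - int i) (?k - j)))"
    by (intro sum.cong refl, subst I_num_convolution[symmetric]) (auto simp: sum_distrib_left)
  also have "\<dots> = (\<Sum>i=1..int n - 1. \<Sum>j=0..?k.
      of_int (i * (int n - i)) * I_num i j * I_num (int n - i) (?k - j))"
    by (rule sum.reindex_bij_witness[of _ nat int])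
      (auto simp: sum_distrib_left of_nat_diff mult.assoc)
  finally have sum_eq: "(\<Sum>i=0..n. \<Sum>a=0..e. of_nat (i * (n - i)) * (I_num (int i) (int a - int i + 1) *
        I_num (int (n - i)) (int (e - a) - int (n - i) + 1))) = \<dots>" .
  have k: "int (Suc e) - int n + 1 = ?k" "int e - int n + 1 = ?k - 1"
    by simp_all
  show ?thesis
  proof (cases "?k < 0")
    case True
    then show ?thesis
      unfolding sum_eq k by (simp add: I_num_eq_0)
  next
    case False
    \<comment> \<open>This is positive, so \<open>(n, k)\<close> is not the initial pair
      \<open>(1, 0)\<close> and the recursive branch applies.\<close>
    have edges: "int n + ?k - 1 = int (Suc e)"
      by simp
    have rec: "I_num (int n) ?k = 1 / (2 * of_nat (Suc e)) *
        (of_nat (n\<^sup>2) * I_num (int n) (?k - 1) + (\<Sum>i=1..int n - 1. \<Sum>j=0..?k.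
          of_int (i * (int n - i)) * I_num i j * I_num (int n - i) (?k - j)))"
      using assms False by (subst I_num.simps, subst edges) simp
    have solve: "2 * c * x = y" if "x = 1 / (2 * c) * y" "c \<noteq> 0" for c x y :: rat
      using that by simp
    show ?thesis
      unfolding sum_eq k by (rule solve[OF rec]) (simp del: of_nat_Suc)
  qed
qed

text \<open>Both sides obey the same recursion in the number \<open>e\<close> of edges. For
  \<open>e = 0\<close> the cyclomatic number \<open>1 - n\<close> is negative unless
  \<open>n \<le> 1\<close>, which leaves only the single vertex.\<close>

theorem connected_gf_nth_nth:
  "connected_gf $ n $ e = of_rat (I_num (int n) (int e - int n + 1))"
proof (induction e arbitrary: n rule: less_induct)
  case (less e)
  show ?case
  proof (cases "n = 0")
    case True
    then show ?thesis
      by (simp add: connected_gf_def I_num_eq_0)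
  next
    case n: False
    show ?thesis
    proof (cases e)
      case 0
      then show ?thesis
        using n by (cases "n = 1") (simp_all add: connected_gf_nth_0 I_num_1_0 I_num_eq_0)
    next
      case (Suc d)
      have IH: "connected_gf $ m $ a = (of_rat (I_num (int m) (int a - int m + 1)) :: 'a)"
        if "a \<le> d" for m a
        using that Suc by (intro less.IH) simp
      have "2 * of_nat (Suc d) * connected_gf $ n $ Suc d =
        of_nat (n\<^sup>2) * of_rat (I_num (int n) (int d - int n + 1)) +
        (\<Sum>i=0..n. \<Sum>a=0..d. of_nat (i * (n - i)) * (of_rat (I_num (int i) (int a - int i + 1)) *
          of_rat (I_num (int (n - i)) (int (d - a) - int (n - i) + 1)) :: 'a))"
        unfolding connected_gf_nth_Suc
        by (intro arg_cong2[of _ _ _ _ "(+)"] sum.cong refl) (simp_all add: IH)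
      also have "\<dots> = of_rat (2 * of_nat (Suc d) * I_num (int n) (int (Suc d) - int n + 1))"
        using n by (subst I_num_Suc_edges) (simp_all add: of_rat_add of_rat_mult of_rat_sum
            del: of_nat_mult of_nat_power)
      also have "\<dots> = 2 * of_nat (Suc d) * of_rat (I_num (int n) (int (Suc d) - int n + 1))"
        by (simp add: of_rat_mult del: of_nat_Suc)
      finally show ?thesis
        using Suc by (simp del: of_nat_Suc)
    qed
  qed
qed

subsection \<open>The sum over compositions\<close>

text \<open>\<open>natpermute\<close> also admits zero parts, but these contribute the factor
  \<open>G $ 0 = 0\<close>.\<close>

lemma fps_power_nth_compositions:
  fixes G :: "'a::comm_ring_1 fps"
  assumes "G $ 0 = 0" "m \<ge> 1"
  shows "(G ^ m) $ n = (\<Sum>ns\<in>compositions n m. \<Prod>x\<leftarrow>ns. G $ x)"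
proof -
  have prod_eq: "(\<Prod>j\<in>{0..m - 1}. G $ (v ! j)) = (\<Prod>x\<leftarrow>v. G $ x)" if "length v = m" for v
    using that assms(2)
    by (subst prod.list_conv_set_nth) (auto intro!: prod.cong)
  have "(G ^ m) $ n = (\<Sum>v\<in>natpermute n m. \<Prod>x\<leftarrow>v. G $ x)"
    unfolding fps_power_nth using assms(2)
    by (simp, intro sum.cong refl) (simp add: natpermute_def flip: prod_eq)
  also have "\<dots> = (\<Sum>ns\<in>compositions n m. \<Prod>x\<leftarrow>ns. G $ x)"
  proof (rule sum.mono_neutral_right)
    have "0 \<in> set v" if "v \<in> natpermute n m - compositions n m" for v
      using that by (force simp: natpermute_def compositions_def)
    then show "\<forall>v\<in>natpermute n m - compositions n m. (\<Prod>x\<leftarrow>v. G $ x) = 0"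
      using assms(1) by (fastforce dest: split_list)
  qed (simp_all add: natpermute_finite, auto simp: natpermute_def compositions_def)
  finally show ?thesis .
qed

text \<open>Subtracting 1 leaves the coefficients at positive indices unchanged, and multiplying
  exponentials adds the squares.\<close>

lemma prod_list_multigraph_gf:
  assumes "\<forall>x\<in>set ns. 0 < x"
  shows "(\<Prod>x\<leftarrow>ns. (multigraph_gf - 1) $ x) =
    fps_const (1 / (\<Prod>x\<leftarrow>ns. fact x)) * fps_exp (of_nat (\<Sum>x\<leftarrow>ns. x\<^sup>2) / (2 :: 'a::field_char_0))"
  using assms
proof (induction ns)
  case Nil
  then show ?case by simp
next
  case (Cons n ns)
  have "fps_exp (of_nat (n\<^sup>2 + (\<Sum>x\<leftarrow>ns. x\<^sup>2)) / 2) =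
      fps_exp (of_nat (n\<^sup>2) / 2) * fps_exp (of_nat (\<Sum>x\<leftarrow>ns. x\<^sup>2) / (2 :: 'a))"
    by (simp only: of_nat_add add_divide_distrib fps_exp_add_mult)
  moreover have "fps_const (1 / (fact n * (\<Prod>x\<leftarrow>ns. fact x))) =
      fps_const (1 / fact n) * fps_const (1 / (\<Prod>x\<leftarrow>ns. fact x :: 'a))"
    by simp
  ultimately show ?case
    using Cons by (simp add: multigraph_gf_nth del: fps_const_mult of_nat_add of_nat_power)
qed

text \<open>The coefficient of \<open>y^e\<close> in \<open>exp (s y / 2)\<close> is
  \<open>s^e / (2^e e!)\<close>, hence the normalising factor on the left.\<close>

lemma connected_gf_nth_compositions:
  "2 ^ e * fact e * connected_gf $ n $ e =
    - (\<Sum>m=1..n. (-1) ^ m / of_nat m * (\<Sum>ns\<in>compositions n m.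
        1 / (\<Prod>x\<leftarrow>ns. fact x) * (of_nat (\<Sum>x\<leftarrow>ns. x\<^sup>2) ^ e :: 'a::field_char_0)))"
proof -
  have power: "((multigraph_gf - 1) ^ m) $ n =
      (\<Sum>ns\<in>compositions n m. fps_const (1 / (\<Prod>x\<leftarrow>ns. fact x)) *
        fps_exp (of_nat (\<Sum>x\<leftarrow>ns. x\<^sup>2) / (2 :: 'a)))" if "m \<in> {1..n}" for m
  proof -
    have "((multigraph_gf - 1 :: 'a fps fps) ^ m) $ n =
        (\<Sum>ns\<in>compositions n m. \<Prod>x\<leftarrow>ns. (multigraph_gf - 1) $ x)"
      using that by (intro fps_power_nth_compositions) auto
    also have "\<dots> = (\<Sum>ns\<in>compositions n m. fps_const (1 / (\<Prod>x\<leftarrow>ns. fact x)) *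
        fps_exp (of_nat (\<Sum>x\<leftarrow>ns. x\<^sup>2) / 2))"
      by (intro sum.cong refl prod_list_multigraph_gf) (simp add: compositions_def)
    finally show ?thesis .
  qed
  have "connected_gf $ n = (\<Sum>m=1..n. fps_const ((-1) ^ (m + 1) / of_nat m) *
      (\<Sum>ns\<in>compositions n m. fps_const (1 / (\<Prod>x\<leftarrow>ns. fact x)) *
        fps_exp (of_nat (\<Sum>x\<leftarrow>ns. x\<^sup>2) / (2 :: 'a))))"
    unfolding connected_gf_def fps2_log1p_def fps_nth_Abs_fps
    by (intro sum.cong refl) (simp add: power)
  then show ?thesis
    by (simp add: fps_sum_nth sum_distrib_left sum_negf[symmetric] power_divide field_simps
        del: of_nat_power)
qed

subsection \<open>The rational function\<close>

lemma has_fps_expansion_geometric: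
  "(\<lambda>t :: complex. 1 / (1 - c * t)) has_fps_expansion Abs_fps (\<lambda>k. c ^ k)"
proof -
  have "(1 - fps_const c * fps_X) * Abs_fps (\<lambda>k. c ^ k) = 1"
  proof (rule fps_ext)
    fix n
    show "((1 - fps_const c * fps_X) * Abs_fps (\<lambda>k. c ^ k)) $ n = 1 $ n"
      by (cases n) (simp_all add: left_diff_distrib mult.assoc)
  qed
  then have "inverse (1 - fps_const c * fps_X) = Abs_fps (\<lambda>k. c ^ k)"
    by (rule fps_inverse_unique)
  moreover have "(\<lambda>t. inverse (1 - c * t)) has_fps_expansion inverse (1 - fps_const c * fps_X)"
    by (intro fps_expansion_intros) simp
  ultimately show ?thesis
    by (simp add: inverse_eq_divide)
qed

text \<open>Below \<open>e = n - 1\<close> the cyclomatic number is negative and the coefficient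
  vanishes. For \<open>e = n - 1 + k\<close>, the factor \<open>2^e e!\<close> equals
  \<open>2^(n-1)\<close> times the normalisation \<open>2^k (n+k-1)!\<close> of
  \<open>J_num\<close>.\<close>

lemma connected_gf_eq_J_num:
  assumes "n \<ge> 1"
  shows "Abs_fps (\<lambda>e. 2 ^ e * fact e * connected_gf $ n $ e) =
    (fps_const 2 * fps_X) ^ (n - 1) * Abs_fps (\<lambda>k. of_rat (J_num n k) :: 'a::field_char_0)"
proof (rule fps_ext)
  fix e
  show "Abs_fps (\<lambda>e. 2 ^ e * fact e * connected_gf $ n $ e) $ e =
    ((fps_const 2 * fps_X) ^ (n - 1) * Abs_fps (\<lambda>k. of_rat (J_num n k) :: 'a)) $ e"
  proof (cases "e < n - 1")
    case True
    then have "int e - int n + 1 < 0"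
      by linarith
    with True show ?thesis
      by (simp add: connected_gf_nth_nth I_num_eq_0 power_mult_distrib mult.assoc fps_X_power_mult_nth)
  next
    case False
    then obtain p k where n: "n = Suc p" and e: "e = p + k"
      using assms by (cases n) (auto simp: not_less dest: le_Suc_ex)
    have "of_rat (fact e) = (fact e :: 'a)"
      by (metis of_nat_fact of_rat_of_nat_eq)
    then show ?thesis
      by (simp add: n e connected_gf_nth_nth power_mult_distrib mult.assoc fps_X_power_mult_nth
          J_num_def power_add of_rat_mult of_rat_power)
  qed
qed

theorem theorem3:
  fixes n :: nat
  assumes "n \<ge> 1"
  shows "J_rational n has_laurent_expansion fps_to_fls (Abs_fps (\<lambda>k. of_rat (J_num n k)))"
proof -
  let ?J = "Abs_fps (\<lambda>k. of_rat (J_num n k) :: complex)"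
  let ?P = "fps_const 2 * fps_X :: complex fps"
  \<comment> \<open>The formula without its singular prefactor: \<open>f\<close> is analytic at 0,
    so it has a power series there, and division by \<open>(2 * t) ^ (n - 1)\<close> can be left to
    Laurent series.\<close>
  define f :: "complex \<Rightarrow> complex" where "f t = - (\<Sum>m=1..n. (-1) ^ m / of_nat m *
      (\<Sum>ns\<in>compositions n m.
         1 / (\<Prod>x\<leftarrow>ns. fact x) * (1 / (1 - of_nat (\<Sum>x\<leftarrow>ns. x\<^sup>2) * t))))" for t
  have "f has_fps_expansion - (\<Sum>m=1..n. fps_const ((-1) ^ m / of_nat m) *
      (\<Sum>ns\<in>compositions n m.
         fps_const (1 / (\<Prod>x\<leftarrow>ns. fact x)) * Abs_fps (\<lambda>k. of_nat (\<Sum>x\<leftarrow>ns. x\<^sup>2) ^ k)))"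
    unfolding f_def
    by (intro has_fps_expansion_minus has_fps_expansion_sum has_fps_expansion_cmult_left
        has_fps_expansion_geometric)
  also have "\<dots> = Abs_fps (\<lambda>e. 2 ^ e * fact e * connected_gf $ n $ e)"
    by (rule fps_ext) (simp add: connected_gf_nth_compositions fps_sum_nth)
  also have "\<dots> = ?P ^ (n - 1) * ?J"
    using assms by (rule connected_gf_eq_J_num)
  finally have "f has_laurent_expansion fps_to_fls (?P ^ (n - 1) * ?J)"
    by (rule has_laurent_expansion_fps)
  moreover have "(\<lambda>t. (2 * t) ^ (n - 1)) has_laurent_expansion fps_to_fls (?P ^ (n - 1))"
    by (intro has_laurent_expansion_fps fps_expansion_intros)
  ultimately have "(\<lambda>t. f t / (2 * t) ^ (n - 1)) has_laurent_expansion
      fps_to_fls (?P ^ (n - 1) * ?J) / fps_to_fls (?P ^ (n - 1))"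
    by (rule has_laurent_expansion_divide)
  also have "\<dots> = fps_to_fls ?J"
    by (simp add: fls_times_fps_to_fls)
  also have "(\<lambda>t. f t / (2 * t) ^ (n - 1)) = J_rational n"
    by (simp add: fun_eq_iff f_def J_rational_def)
  finally show ?thesis .
qed

end
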